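(* The generating functions $M_{\mathrm I}(x,y;t)$ and $M_{\mathrm{II}}(x,y;t)$ of Motzkin N-walks of type I and type II, as well as the generating function $M(x,y;t)=M_{\mathrm I}(x,y;t)+M_{\mathrm{II}}(x,y;t)$ of all Motzkin N-walks, are rational.
   Context: An N-step is a non-empty finite set of integers. Motzkin N-walks are finite sequences $w=(s_1,\dots,s_n)$ of N-steps from $S_M=\{\{-1\},\{0\},\{1\},\{-1,0\},\{-1,1\},\{0,1\},\{-1,0,1\}\}$, starting at $0$, $|w|=n$. The reachable points $\operatorname{reach}(w)$ are the endpoints $v_1+\dots+v_n$ of all integer sequences with $v_i\in s_i$; $\min(w),\max(w)$ are their minimum and maximum, and $\|w\|=\max(w)-\min(w)$. $w$ is of type I if $\operatorname{reach}(w)=\{\min(w)+i: i=0,\dots,\|w\|\}$ and $\|w\|\ge1$, and of type II if $\operatorname{reach}(w)=\{\min(w)+2i: i=0,\dots,\|w\|/2\}$. $M_{\mathrm I}(x,y;t)=\sum_w x^{\min(w)}y^{\max(w)}t^{|w|}$ over Motzkin N-walks of type I, and $M_{\mathrm{II}}$ likewise for type II. *)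

theory Defs
  imports
    "HOL-Library.Poly_Mapping"
    "HOL-Library.Product_Plus"
    "HOL-Computational_Algebra.Polynomial_FPS"
begin

definition motzkin_steps :: "int set set" where
  "motzkin_steps = {{-1}, {0}, {1}, {-1, 0}, {-1, 1}, {0, 1}, {-1, 0, 1}}"

definition motzkin_walks :: "int set list set" where
  "motzkin_walks = {w. set w \<subseteq> motzkin_steps}"

definition reach :: "int set list \<Rightarrow> int set" where
  "reach w = {sum_list v | v. list_all2 (\<in>) v w}"

definition walk_min :: "int set list \<Rightarrow> int" where
  "walk_min w = Min (reach w)"

definition walk_max :: "int set list \<Rightarrow> int" where
  "walk_max w = Max (reach w)"

definition walk_width :: "int set list \<Rightarrow> int" where
  "walk_width w = walk_max w - walk_min w"

definition type_I :: "int set list \<Rightarrow> bool" where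
  "type_I w \<longleftrightarrow>
     reach w = {walk_min w + i | i. i \<in> {0..walk_width w}} \<and> walk_width w \<ge> 1"

(* For odd width the set on the right misses walk_max w, so a walk of type II
   automatically has even width and the rounding in div is harmless. *)
definition type_II :: "int set list \<Rightarrow> bool" where
  "type_II w \<longleftrightarrow>
     reach w = {walk_min w + 2 * i | i. i \<in> {0..walk_width w div 2}}"

(* Laurent polynomials in x, y over the rationals, as the group algebra of
   int \<times> int: the monomial x^i y^j is single (i, j) 1. *)
type_synonym laurent2 = "(int \<times> int) \<Rightarrow>\<^sub>0 rat"

(* Formal power series in t. The coefficient of t^n is a finite sum, since there
   are 7^n Motzkin walks of length n. *)
definition motzkin_gf :: "(int set list \<Rightarrow> bool) \<Rightarrow> laurent2 fps" where
  "motzkin_gf T = Abs_fps (\<lambda>n. \<Sum>w | w \<in> motzkin_walks \<and> length w = n \<and> T w.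
     Poly_Mapping.single (walk_min w, walk_max w) 1)"

definition M_I :: "laurent2 fps" where
  "M_I = motzkin_gf type_I"

definition M_II :: "laurent2 fps" where
  "M_II = motzkin_gf type_II"

definition M_all :: "laurent2 fps" where
  "M_all = motzkin_gf (\<lambda>_. True)"

definition nonneg_exponents :: "laurent2 \<Rightarrow> bool" where
  "nonneg_exponents p \<longleftrightarrow> (\<forall>(i, j) \<in> Poly_Mapping.keys p. 0 \<le> i \<and> 0 \<le> j)"

(* F = P / Q for polynomials P, Q in x, y, t with Q nonzero. A polynomial in
   x, y, t is a polynomial in t whose coefficients involve no negative powers
   of x and y. *)
definition rational_gf :: "laurent2 fps \<Rightarrow> bool" where
  "rational_gf F \<longleftrightarrow> (\<exists>P Q :: laurent2 poly.
     (\<forall>n. nonneg_exponents (poly.coeff P n)) \<and>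
     (\<forall>n. nonneg_exponents (poly.coeff Q n)) \<and>
     Q \<noteq> 0 \<and> fps_of_poly Q * F = fps_of_poly P)"

end

theory Submission
  imports Defs
begin

text \<open>Minimum and maximum of the reachable set are additive along a walk, so walks over a fixed
  set \<open>S\<close> of steps have generating function \<open>1 / (1 - t * a)\<close> with \<open>a\<close> the Laurent
  polynomial of \<open>S\<close>. The reachable set keeps the parity structure of type II as long as only
  the steps \<open>{-1}\<close>, \<open>{0}\<close>, \<open>{1}\<close>, \<open>{-1, 1}\<close> are used; any other step
  fills the gaps and the walk stays of type I from then on. Hence the walks of type II are exactly
  the walks over these four steps, and the walks of type I are all the others.\<close>

section \<open>Reachable sets and their extrema\<close>

definition parity_steps :: "int set set" where
  "parity_steps = {{-1}, {0}, {1}, {-1, 1}}"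

lemma parity_steps_subset: "parity_steps \<subseteq> motzkin_steps"
  by (auto simp: parity_steps_def motzkin_steps_def)

lemma finite_motzkin_steps: "finite motzkin_steps"
  by (simp add: motzkin_steps_def)

lemma motzkin_stepD:
  assumes "s \<in> motzkin_steps"
  shows "finite s" "s \<noteq> {}" "-1 \<le> Min s" "-1 \<le> Max s"
  using assms by (auto simp: motzkin_steps_def)

lemma reach_Nil [simp]: "reach [] = {0}"
  by (auto simp: reach_def)

lemma reach_Cons: "reach (s # w) = (\<Union>a\<in>s. (+) a ` reach w)"
proof -
  have "x \<in> reach (s # w) \<longleftrightarrow> (\<exists>a\<in>s. \<exists>b\<in>reach w. x = a + b)" for x
  proof
    assume "x \<in> reach (s # w)"
    then show "\<exists>a\<in>s. \<exists>b\<in>reach w. x = a + b"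
      by (auto simp: reach_def list_all2_Cons2) blast
  next
    assume "\<exists>a\<in>s. \<exists>b\<in>reach w. x = a + b"
    then obtain a v where "a \<in> s" "list_all2 (\<in>) v w" "x = sum_list (a # v)"
      by (auto simp: reach_def)
    then show "x \<in> reach (s # w)"
      unfolding reach_def by (blast intro: list_all2_Cons[THEN iffD2])
  qed
  then show ?thesis by (auto simp: image_iff)
qed

text \<open>Over a concrete step \<open>s\<close> the quantifier becomes a finite disjunction, which
  turns the case analyses below into linear integer arithmetic.\<close>

lemma mem_reach_Cons: "x \<in> reach (s # w) \<longleftrightarrow> (\<exists>a\<in>s. x - a \<in> reach w)"
proof -
  have "x \<in> (+) a ` reach w \<longleftrightarrow> x - a \<in> reach w" for a
    by (auto intro: image_eqI[of x "(+) a" "x - a"])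
  then show ?thesis by (simp add: reach_Cons)
qed

lemma reach_finite_nonempty:
  assumes "w \<in> motzkin_walks"
  shows "finite (reach w)" "reach w \<noteq> {}"
proof -
  have "finite (reach w) \<and> reach w \<noteq> {}"
    using assms
    by (induction w) (auto simp: motzkin_walks_def reach_Cons dest: motzkin_stepD)
  then show "finite (reach w)" "reach w \<noteq> {}" by auto
qed

text \<open>\<open>reach (s # w)\<close> is the Minkowski sum of \<open>s\<close> and
  \<open>reach w\<close>, so the two summands can be minimised and maximised independently.\<close>

lemma walk_min_max_Cons:
  assumes "s \<in> motzkin_steps" "w \<in> motzkin_walks"
  shows "walk_min (s # w) = Min s + walk_min w" "walk_max (s # w) = Max s + walk_max w"
proof -
  note s = motzkin_stepD[OF assms(1)] and r = reach_finite_nonempty[OF assms(2)]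
  have fin: "finite (reach (s # w))" unfolding reach_Cons using s r by auto
  have mem: "Min s + Min (reach w) \<in> reach (s # w)" "Max s + Max (reach w) \<in> reach (s # w)"
    unfolding mem_reach_Cons using s r Min_in Max_in by (metis add_diff_cancel_left')+
  show "walk_min (s # w) = Min s + walk_min w"
    unfolding walk_min_def
    using s r by (intro Min_eqI fin mem) (auto simp: reach_Cons intro!: add_mono)
  show "walk_max (s # w) = Max s + walk_max w"
    unfolding walk_max_def
    using s r by (intro Max_eqI fin mem) (auto simp: reach_Cons intro!: add_mono)
qed

section \<open>Shape of the reachable set and the two types\<close>

text \<open>A singleton step translates the progression; \<open>{-1, 1}\<close> unites two
  translates at distance 2, which again have the same parity and leave no further gap. Evenness of
  \<open>n - m\<close> guarantees that \<open>n\<close> itself is reached, so \<open>m\<close> and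
  \<open>n\<close> are the extrema.\<close>

lemma reach_parity_steps:
  assumes "set w \<subseteq> parity_steps"
  shows "\<exists>m n. reach w = {x \<in> {m..n}. even (x - m)} \<and> m \<le> n \<and> even (n - m)"
  using assms
proof (induction w)
  case Nil
  have "reach [] = {x \<in> {0..0}. even (x - 0)}" by auto
  then show ?case by (metis diff_self even_zero order_refl)
next
  case (Cons s w)
  then obtain m n where r: "reach w = {x \<in> {m..n}. even (x - m)}" "m \<le> n" "even (n - m)"
    by auto
  have *: "x \<in> reach (s # w) \<longleftrightarrow> (\<exists>a\<in>s. m \<le> x - a \<and> x - a \<le> n \<and> even (x - a - m))" for x
    unfolding mem_reach_Cons r(1) by simp
  from Cons.prems consider "s = {-1}" | "s = {0}" | "s = {1}" | "s = {-1, 1}"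
    by (auto simp: parity_steps_def)
  then show ?case
  proof cases
    case 1
    then have "x \<in> reach (s # w) \<longleftrightarrow> x \<in> {x \<in> {m-1..n-1}. even (x - (m-1))}" for x
      unfolding * using r(2,3) by simp presburger
    then have "reach (s # w) = {x \<in> {m-1..n-1}. even (x - (m-1))}" by blast
    moreover have "m-1 \<le> n-1" "even ((n-1) - (m-1))" using r by auto
    ultimately show ?thesis by blast
  next
    case 2
    then have "x \<in> reach (s # w) \<longleftrightarrow> x \<in> {x \<in> {m..n}. even (x - m)}" for x
      unfolding * by simp
    then have "reach (s # w) = {x \<in> {m..n}. even (x - m)}" by blast
    then show ?thesis using r by blast
  next
    case 3
    then have "x \<in> reach (s # w) \<longleftrightarrow> x \<in> {x \<in> {m+1..n+1}. even (x - (m+1))}" for x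
      unfolding * using r(2,3) by simp presburger
    then have "reach (s # w) = {x \<in> {m+1..n+1}. even (x - (m+1))}" by blast
    moreover have "m+1 \<le> n+1" "even ((n+1) - (m+1))" using r by auto
    ultimately show ?thesis by blast
  next
    case 4
    then have "x \<in> reach (s # w) \<longleftrightarrow> x \<in> {x \<in> {m-1..n+1}. even (x - (m-1))}" for x
      unfolding * using r(2,3) by simp presburger
    then have "reach (s # w) = {x \<in> {m-1..n+1}. even (x - (m-1))}" by blast
    moreover have "m-1 \<le> n+1" "even ((n+1) - (m-1))" using r by auto
    ultimately show ?thesis by blast
  qed
qed

lemma reach_not_parity_steps:
  assumes "w \<in> motzkin_walks" "\<not> set w \<subseteq> parity_steps"
  shows "\<exists>m n. reach w = {m..n} \<and> m < n"
  using assms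
proof (induction w)
  case Nil
  then show ?case by simp
next
  case (Cons s w)
  then have w: "w \<in> motzkin_walks" and s: "s \<in> motzkin_steps"
    by (auto simp: motzkin_walks_def)
  show ?case
  proof (cases "set w \<subseteq> parity_steps")
    case True
    then obtain m n where r: "reach w = {x \<in> {m..n}. even (x - m)}" "m \<le> n" "even (n - m)"
      using reach_parity_steps by blast
    have *: "x \<in> reach (s # w) \<longleftrightarrow> (\<exists>a\<in>s. m \<le> x - a \<and> x - a \<le> n \<and> even (x - a - m))" for x
      unfolding mem_reach_Cons r(1) by simp
    \<comment> \<open>Here \<open>s\<close> is the only step outside \<open>parity_steps\<close>.
      Each of the three candidates contains two adjacent integers, so translates of both parities
      interleave to an interval.\<close>
    from s True Cons.prems(2) consider "s = {-1, 0}" | "s = {0, 1}" | "s = {-1, 0, 1}"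
      by (auto simp: motzkin_steps_def parity_steps_def)
    then show ?thesis
    proof cases
      case 1
      then have "x \<in> reach (s # w) \<longleftrightarrow> x \<in> {m-1..n}" for x
        unfolding * using r(2,3) by simp presburger
      then have "reach (s # w) = {m-1..n}" by blast
      then show ?thesis using r(2) by (intro exI[of _ "m-1"] exI[of _ "n"]) simp
    next
      case 2
      then have "x \<in> reach (s # w) \<longleftrightarrow> x \<in> {m..n+1}" for x
        unfolding * using r(2,3) by simp presburger
      then have "reach (s # w) = {m..n+1}" by blast
      then show ?thesis using r(2) by (intro exI[of _ "m"] exI[of _ "n+1"]) simp
    next
      case 3
      then have "x \<in> reach (s # w) \<longleftrightarrow> x \<in> {m-1..n+1}" for x
        unfolding * using r(2,3) by simp presburger
      then have "reach (s # w) = {m-1..n+1}" by blast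
      then show ?thesis using r(2) by (intro exI[of _ "m-1"] exI[of _ "n+1"]) simp
    qed
  next
    case False
    then obtain m n where r: "reach w = {m..n}" "m < n" using Cons.IH w by blast
    \<comment> \<open>Translates by 0 and 1 or -1 always join up. For \<open>{-1, 1}\<close> the
      translates \<open>{m-1..n-1}\<close> and \<open>{m+1..n+1}\<close> leave no gap precisely
      because \<open>m < n\<close>.\<close>
    have "x \<in> reach (s # w) \<longleftrightarrow> x \<in> {m + Min s..n + Max s}" for x
      unfolding mem_reach_Cons r(1) using s r(2)
      by (simp add: motzkin_steps_def) (elim disjE; simp; presburger)
    then have "reach (s # w) = {m + Min s..n + Max s}" by blast
    moreover have "Min s \<le> Max s" using motzkin_stepD[OF s] by simp
    ultimately show ?thesis using r(2) by (intro exI[of _ "m + Min s"] exI[of _ "n + Max s"]) simp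
  qed
qed

lemma parity_steps_types:
  assumes "set w \<subseteq> parity_steps"
  shows "type_II w" "\<not> type_I w"
proof -
  obtain m n where r: "reach w = {x \<in> {m..n}. even (x - m)}" "m \<le> n" "even (n - m)"
    using reach_parity_steps[OF assms] by blast
  have fin: "finite {x \<in> {m..n}. even (x - m)}"
    by (rule finite_subset[of _ "{m..n}"]) auto
  have mn: "walk_min w = m" "walk_max w = n"
    unfolding walk_min_def walk_max_def r(1) using r(2,3)
    by (intro Min_eqI Max_eqI fin; auto)+
  have "x \<in> reach w \<longleftrightarrow> (\<exists>i. x = m + 2 * i \<and> 0 \<le> i \<and> i \<le> (n - m) div 2)" for x
    unfolding r(1) using r(2,3) by simp presburger
  then show "type_II w" unfolding type_II_def walk_width_def mn by auto
  \<comment> \<open>The point \<open>m + 1\<close> has the wrong parity, yet type I would force it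
    into \<open>reach w\<close>. Width 0 is excluded by the bound in \<open>type_I\<close>.\<close>
  have "m + 1 \<notin> reach w" unfolding r(1) by simp
  moreover have "m + 1 \<in> {m + i |i. i \<in> {0..n - m}}" if "n - m \<ge> 1" using that by auto
  ultimately show "\<not> type_I w" unfolding type_I_def walk_width_def mn by blast
qed

lemma not_parity_steps_types:
  assumes "w \<in> motzkin_walks" "\<not> set w \<subseteq> parity_steps"
  shows "\<not> type_II w" "type_I w"
proof -
  obtain m n where r: "reach w = {m..n}" "m < n"
    using reach_not_parity_steps[OF assms] by blast
  have mn: "walk_min w = m" "walk_max w = n"
    unfolding walk_min_def walk_max_def r(1) using r(2)
    by (auto intro!: Min_eqI Max_eqI)
  \<comment> \<open>The same point now refutes type II: it is reachable at odd distance from the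
    minimum.\<close>
  have "m + 1 \<in> reach w" unfolding r(1) using r(2) by simp
  moreover have "m + 1 \<noteq> m + 2 * i" for i by presburger
  ultimately show "\<not> type_II w" unfolding type_II_def walk_width_def mn by blast
  have "x \<in> reach w \<longleftrightarrow> (\<exists>i. x = m + i \<and> 0 \<le> i \<and> i \<le> n - m)" for x
    unfolding r(1) by simp presburger
  then show "type_I w" unfolding type_I_def walk_width_def mn using r(2) by auto
qed

lemma type_II_iff: "w \<in> motzkin_walks \<Longrightarrow> type_II w \<longleftrightarrow> set w \<subseteq> parity_steps"
  and type_I_iff: "w \<in> motzkin_walks \<Longrightarrow> type_I w \<longleftrightarrow> \<not> set w \<subseteq> parity_steps"
  using parity_steps_types not_parity_steps_types by blast+

section \<open>Walks over a step set as a geometric series\<close>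

definition step_poly :: "int set set \<Rightarrow> laurent2" where
  "step_poly S = (\<Sum>s\<in>S. Poly_Mapping.single (Min s, Max s) 1)"

text \<open>Since minimum and maximum add up along a walk, its monomial is the product of the
  monomials of its steps, and splitting off the first step factors the sum.\<close>

lemma sum_walks:
  assumes "S \<subseteq> motzkin_steps"
  shows "(\<Sum>w | set w \<subseteq> S \<and> length w = n. Poly_Mapping.single (walk_min w, walk_max w) 1)
    = step_poly S ^ n"
proof (induction n)
  case 0
  have "{w. set w \<subseteq> S \<and> length w = 0} = {[]}" by auto
  \<comment> \<open>The empty walk has the monomial with exponent \<open>(0, 0)\<close>; reading
    this pair as \<open>0\<close> identifies it with the unit of the group algebra.\<close>
  then show ?case
    by (simp add: walk_min_def walk_max_def single_one flip: zero_prod_def)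
next
  case (Suc n)
  let ?W = "\<lambda>n. {w. set w \<subseteq> S \<and> length w = n}"
  let ?g = "\<lambda>w. Poly_Mapping.single (walk_min w, walk_max w) (1 :: rat)"
  have "?W (Suc n) = (\<lambda>(s, w). s # w) ` (S \<times> ?W n)"
    by (auto simp: length_Suc_conv image_iff)
  then have "(\<Sum>w\<in>?W (Suc n). ?g w) = (\<Sum>(s, w)\<in>S \<times> ?W n. ?g (s # w))"
    by (simp add: sum.reindex inj_on_def case_prod_unfold)
  also have "\<dots> = (\<Sum>(s, w)\<in>S \<times> ?W n. Poly_Mapping.single (Min s, Max s) 1 * ?g w)"
    using assms
    by (intro sum.cong) (auto simp: walk_min_max_Cons motzkin_walks_def mult_single subset_iff)
  also have "\<dots> = step_poly S * (\<Sum>w\<in>?W n. ?g w)"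
    by (simp add: step_poly_def sum_product sum.cartesian_product)
  finally show ?case using Suc.IH by simp
qed

lemma motzkin_gf_steps:
  assumes "S \<subseteq> motzkin_steps"
    and "\<And>w. w \<in> motzkin_walks \<Longrightarrow> T w \<longleftrightarrow> set w \<subseteq> S"
  shows "motzkin_gf T = Abs_fps (\<lambda>n. step_poly S ^ n)"
proof -
  have "{w \<in> motzkin_walks. length w = n \<and> T w} = {w. set w \<subseteq> S \<and> length w = n}" for n
    using assms by (auto simp: motzkin_walks_def)
  then show ?thesis
    unfolding motzkin_gf_def by (simp add: sum_walks[OF assms(1)])
qed

section \<open>Polynomial numerators and denominators\<close>

lemma nonneg_exponents_zero: "nonneg_exponents 0"
  by (simp add: nonneg_exponents_def)

lemma nonneg_exponents_single: "0 \<le> i \<Longrightarrow> 0 \<le> j \<Longrightarrow> nonneg_exponents (Poly_Mapping.single (i, j) c)"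
  by (simp add: nonneg_exponents_def)

lemma nonneg_exponents_diff:
  assumes "nonneg_exponents p" "nonneg_exponents q"
  shows "nonneg_exponents (p - q)"
  using assms keys_diff[of p q] by (fastforce simp: nonneg_exponents_def)

lemma nonneg_exponents_sum:
  assumes "\<And>a. a \<in> A \<Longrightarrow> nonneg_exponents (f a)"
  shows "nonneg_exponents (sum f A)"
  using assms Poly_Mapping.keys_sum[of f A] by (fastforce simp: nonneg_exponents_def)

lemma nonneg_exponents_mult:
  assumes "nonneg_exponents p" "nonneg_exponents q"
  shows "nonneg_exponents (p * q)"
  using assms keys_mult[of p q] by (fastforce simp: nonneg_exponents_def)

lemma single_one_neq_zero: "Poly_Mapping.single k (1 :: rat) \<noteq> 0"
  by (metis lookup_single_eq lookup_zero zero_neq_one)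

text \<open>The denominator \<open>1 - t * a\<close>, multiplied by \<open>x * y\<close> to clear the negative exponents.\<close>

definition denom :: "int set set \<Rightarrow> laurent2 poly" where
  "denom S = [:Poly_Mapping.single (1, 1) 1, - (Poly_Mapping.single (1, 1) 1 * step_poly S):]"

abbreviation numer :: "laurent2 poly" where
  "numer \<equiv> [:Poly_Mapping.single (1, 1) 1:]"

lemma denom_times_gf:
  "fps_of_poly (denom S) * Abs_fps (\<lambda>n. step_poly S ^ n) = fps_of_poly numer"
proof -
  have "fps_of_poly (denom S) = fps_const (Poly_Mapping.single (1, 1) 1) *
      (1 - fps_X * fps_const (step_poly S))"
    by (rule fps_ext)
       (simp add: denom_def coeff_pCons split: nat.split)
  \<comment> \<open>The coefficients telescope: for positive \<open>n\<close> the power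
    \<open>a^n\<close> cancels against \<open>a * a^(n-1)\<close>, leaving only the constant
    1.\<close>
  moreover have "(1 - fps_X * fps_const (step_poly S)) * Abs_fps (\<lambda>n. step_poly S ^ n) = 1"
    by (rule fps_ext)
       (auto simp: left_diff_distrib mult.assoc power_eq_if)
  ultimately show ?thesis by (simp only: mult.assoc mult_1_right fps_of_poly_const)
qed

lemma nonneg_exponents_numer: "nonneg_exponents (poly.coeff numer n)"
  by (simp add: coeff_pCons nonneg_exponents_single nonneg_exponents_zero split: nat.split)

text \<open>Every Motzkin step has minimum and maximum at least -1, so one factor x and one factor y
  suffice.\<close>

lemma nonneg_exponents_denom:
  assumes "S \<subseteq> motzkin_steps"
  shows "nonneg_exponents (poly.coeff (denom S) n)"
proof -
  have "nonneg_exponents (Poly_Mapping.single (1, 1) 1 * step_poly S)"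
    unfolding step_poly_def sum_distrib_left mult_single
    using assms motzkin_stepD(3,4)
    by (intro nonneg_exponents_sum) (force intro!: nonneg_exponents_single)
  then have "nonneg_exponents (- (Poly_Mapping.single (1, 1) 1 * step_poly S))"
    by (simp add: nonneg_exponents_def)
  then show ?thesis
    by (simp add: denom_def coeff_pCons nonneg_exponents_single nonneg_exponents_zero
        split: nat.split)
qed

lemma nonneg_exponents_poly_mult:
  assumes "\<And>n. nonneg_exponents (poly.coeff p n)" "\<And>n. nonneg_exponents (poly.coeff q n)"
  shows "nonneg_exponents (poly.coeff (p * q) n)"
  unfolding coeff_mult using assms by (intro nonneg_exponents_sum nonneg_exponents_mult)

lemma rational_gf_steps:
  assumes "S \<subseteq> motzkin_steps"
  shows "rational_gf (Abs_fps (\<lambda>n. step_poly S ^ n))"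
  unfolding rational_gf_def
proof (intro exI conjI allI)
  show "denom S \<noteq> 0" by (simp add: denom_def single_one_neq_zero)
qed (rule nonneg_exponents_numer nonneg_exponents_denom[OF assms] denom_times_gf)+

lemma rational_gf_steps_diff:
  assumes "S \<subseteq> motzkin_steps" "S' \<subseteq> motzkin_steps"
  shows "rational_gf (Abs_fps (\<lambda>n. step_poly S ^ n) - Abs_fps (\<lambda>n. step_poly S' ^ n))"
    (is "rational_gf (?F - ?F')")
  unfolding rational_gf_def
proof (intro exI conjI allI)
  note * = nonneg_exponents_denom[OF assms(1)] nonneg_exponents_denom[OF assms(2)]
  show "nonneg_exponents (poly.coeff (denom S' * numer - denom S * numer) n)" for n
    unfolding coeff_diff
    by (intro nonneg_exponents_diff nonneg_exponents_poly_mult * nonneg_exponents_numer)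
  show "nonneg_exponents (poly.coeff (denom S * denom S') n)" for n
    by (intro nonneg_exponents_poly_mult *)
  \<comment> \<open>The constant coefficient in t is x^2 y^2, so no argument about zero divisors is
    needed.\<close>
  have "poly.coeff (denom S * denom S') 0 \<noteq> 0"
    by (simp add: coeff_mult denom_def mult_single single_one_neq_zero)
  then show "denom S * denom S' \<noteq> 0" by force
  \<comment> \<open>Regrouping over the common denominator lets each denominator meet its own
    series.\<close>
  have "fps_of_poly (denom S * denom S') * (?F - ?F') =
      fps_of_poly (denom S') * (fps_of_poly (denom S) * ?F)
      - fps_of_poly (denom S) * (fps_of_poly (denom S') * ?F')"
    by (simp add: fps_of_poly_mult algebra_simps)
  then show "fps_of_poly (denom S * denom S') * (?F - ?F') =
      fps_of_poly (denom S' * numer - denom S * numer)"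
    by (simp only: denom_times_gf fps_of_poly_mult fps_of_poly_diff)
qed

section \<open>Combining the two types\<close>

lemma M_all_eq: "M_all = M_I + M_II"
proof (rule fps_ext)
  fix n
  let ?W = "\<lambda>T. {w \<in> motzkin_walks. length w = n \<and> T w}"
  have "?W (\<lambda>_. True) = ?W type_I \<union> ?W type_II" "?W type_I \<inter> ?W type_II = {}"
    using type_I_iff type_II_iff by auto
  moreover have "finite (?W T)" for T
    using finite_lists_length_eq[OF finite_motzkin_steps, of n]
    by (rule rev_finite_subset) (auto simp: motzkin_walks_def)
  ultimately show "fps_nth M_all n = fps_nth (M_I + M_II) n"
    by (simp add: M_all_def M_I_def M_II_def motzkin_gf_def sum.union_disjoint)
qed

theorem theorem3p3:
  "rational_gf M_I \<and> rational_gf M_II \<and> M_all = M_I + M_II \<and> rational_gf M_all"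
proof -
  have II: "M_II = Abs_fps (\<lambda>n. step_poly parity_steps ^ n)"
    unfolding M_II_def by (intro motzkin_gf_steps parity_steps_subset type_II_iff)
  have all: "M_all = Abs_fps (\<lambda>n. step_poly motzkin_steps ^ n)"
    unfolding M_all_def by (intro motzkin_gf_steps) (auto simp: motzkin_walks_def)
  \<comment> \<open>Type I is the complement of a step restriction, so its series is reached as a
    difference of two geometric series.\<close>
  have "M_I = M_all - M_II" by (simp add: M_all_eq)
  then have "rational_gf M_I"
    unfolding II all using rational_gf_steps_diff[OF order_refl parity_steps_subset] by simp
  then show ?thesis
    using M_all_eq rational_gf_steps[OF order_refl] rational_gf_steps[OF parity_steps_subset]
    by (simp add: II all)
qed

end
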